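(* The universal displacements in trigonal $\mathbb{D}_3$ class linear strain-gradient elastic solids are the superposition of homogeneous displacement fields and the inhomogeneous displacement field $$u_1^{\mathrm{inh}}=a_{123}x_1x_2x_3+a_{12}x_1x_2+a_{13}x_1x_3+a_{23}x_2x_3,$$ $$u_2^{\mathrm{inh}}=\tfrac12(a_{12}+a_{123}x_3)(x_1^2-x_2^2)+b_{13}x_1x_3-a_{13}x_2x_3,$$ $$u_3^{\mathrm{inh}}=-a_{123}x_1^2x_2-(a_{23}+b_{13})x_1x_2+\tfrac13a_{123}x_2^3-a_{13}(x_1^2-x_2^2),$$ with $a_{123}=0$, where $a_{12},a_{13},a_{23},b_{13}$ are arbitrary real constants.
   Context: The body is three-dimensional, with Cartesian coordinates $(x_1,x_2,x_3)$ and orthonormal basis $e_1,e_2,e_3$; no condition is imposed on the region it occupies. Repeated indices are summed over $1,2,3$ and a comma denotes partial differentiation. A displacement field is a smooth vector field $\mathbf{u}=(u_1,u_2,u_3)$ on the body, with strain $e_{lm}=\tfrac12(u_{l,m}+u_{m,l})$. It is homogeneous if $\mathbf{u}(\mathbf{x})=\mathbf{H}\mathbf{x}+\mathbf{b}$ for a constant matrix $\mathbf{H}$ and a constant vector $\mathbf{b}$. A linear strain-gradient (Toupin--Mindlin) material is a triple $(\mathsf{C},\mathsf{M},\mathsf{A})$ of constant real tensors of orders $4,5,6$ with index symmetries $\mathsf{C}_{ijlm}=\mathsf{C}_{jilm}=\mathsf{C}_{lmij}$, $\mathsf{M}_{ijklm}=\mathsf{M}_{jiklm}=\mathsf{M}_{ijlkm}$,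 $\mathsf{A}_{ijklmn}=\mathsf{A}_{jiklmn}=\mathsf{A}_{lmnijk}$. Its stress and hyper-stress are $\sigma_{ij}=\mathsf{C}_{ijlm}e_{lm}+\mathsf{M}_{ijlmn}e_{lm,n}$ and $\tau_{ijk}=\mathsf{M}_{lmijk}e_{lm}+\mathsf{A}_{ijklmn}e_{lm,n}$, and the equilibrium equations without body forces are $\sigma_{ij,j}-\tau_{ijk,jk}=0$ for $i=1,2,3$. For a subgroup $G\subset \mathrm{O}(3)$, a tensor $T$ of order $p$ is $G$-invariant if $Q_{i_1j_1}\cdots Q_{i_pj_p}T_{j_1\dots j_p}=T_{i_1\dots i_p}$ for all $Q\in G$. $\mathbb{D}_3$ is the dihedral group generated by the rotation by $2\pi/3$ about $e_3$ and the rotation by $\pi$ about $e_1$; $\mathbb{Z}_2^c=\{I,-I\}$, and $\mathbb{D}_3\oplus\mathbb{Z}_2^c$ is the group generated by $\mathbb{D}_3$ and $-I$. The trigonal class $\mathbb{D}_3$ is the set of all materials with $\mathsf{C}$ and $\mathsf{A}$ $\mathbb{D}_3\oplus\mathbb{Z}_2^c$-invariant (6 and 34 independent constants) and $\mathsf{M}$ $\mathbb{D}_3$-invariant (16 independent constants), 56 independent constants in total. A displacement field is universal for the class if it satisfies the equilibrium equations for every material in the class.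
   Formalization: The two-fold axis of D3 is taken to be e2 instead of e1, since with e1 the displayed a12 field violates equilibrium (C_1123 = -C_2223 = C_1312 nonzero); the body is taken to be an open connected set, since constants could differ between components. *)

theory Defs
  imports "HOL-Analysis.Analysis" "HOL-Algebra.Generated_Groups"
begin

(* The index type 3 has the elements 1, 2 and 3 (= 0); sums over UNIV :: 3 set are the
   implicit sums over repeated indices. *)

definition pd :: "3 \<Rightarrow> (real^3 \<Rightarrow> real) \<Rightarrow> real^3 \<Rightarrow> real" where
  "pd i f x = deriv (\<lambda>t. f (x + t *\<^sub>R axis i 1)) 0"

(* On an open set this is C-infinity: Frechet differentiability of all iterated partial
   derivatives makes each of them continuous. Only values of f on B matter when B is open. *)
definition smooth_on :: "(real^3) set \<Rightarrow> (real^3 \<Rightarrow> real) \<Rightarrow> bool" where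
  "smooth_on B f \<longleftrightarrow> (\<forall>is :: 3 list. \<forall>x\<in>B. foldr pd is f differentiable (at x))"

definition displacement_field :: "(real^3) set \<Rightarrow> (real^3 \<Rightarrow> real^3) \<Rightarrow> bool" where
  "displacement_field B u \<longleftrightarrow> (\<forall>i. smooth_on B (\<lambda>x. u x $ i))"

definition strain :: "(real^3 \<Rightarrow> real^3) \<Rightarrow> 3 \<Rightarrow> 3 \<Rightarrow> real^3 \<Rightarrow> real" where
  "strain u l m x = (pd m (\<lambda>y. u y $ l) x + pd l (\<lambda>y. u y $ m) x) / 2"

type_synonym tensor4 = "3 \<Rightarrow> 3 \<Rightarrow> 3 \<Rightarrow> 3 \<Rightarrow> real"
type_synonym tensor5 = "3 \<Rightarrow> 3 \<Rightarrow> 3 \<Rightarrow> 3 \<Rightarrow> 3 \<Rightarrow> real"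
type_synonym tensor6 = "3 \<Rightarrow> 3 \<Rightarrow> 3 \<Rightarrow> 3 \<Rightarrow> 3 \<Rightarrow> 3 \<Rightarrow> real"

definition material :: "tensor4 \<Rightarrow> tensor5 \<Rightarrow> tensor6 \<Rightarrow> bool" where
  "material C M A \<longleftrightarrow>
     (\<forall>i j l m. C i j l m = C j i l m \<and> C i j l m = C l m i j) \<and>
     (\<forall>i j k l m. M i j k l m = M j i k l m \<and> M i j k l m = M i j l k m) \<and>
     (\<forall>i j k l m n. A i j k l m n = A j i k l m n \<and> A i j k l m n = A l m n i j k)"

definition stress ::
  "tensor4 \<Rightarrow> tensor5 \<Rightarrow> (real^3 \<Rightarrow> real^3) \<Rightarrow> 3 \<Rightarrow> 3 \<Rightarrow> real^3 \<Rightarrow> real" where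
  "stress C M u i j x =
     (\<Sum>l\<in>UNIV. \<Sum>m\<in>UNIV. C i j l m * strain u l m x) +
     (\<Sum>l\<in>UNIV. \<Sum>m\<in>UNIV. \<Sum>n\<in>UNIV. M i j l m n * pd n (strain u l m) x)"

definition hyperstress ::
  "tensor5 \<Rightarrow> tensor6 \<Rightarrow> (real^3 \<Rightarrow> real^3) \<Rightarrow> 3 \<Rightarrow> 3 \<Rightarrow> 3 \<Rightarrow> real^3 \<Rightarrow> real" where
  "hyperstress M A u i j k x =
     (\<Sum>l\<in>UNIV. \<Sum>m\<in>UNIV. M l m i j k * strain u l m x) +
     (\<Sum>l\<in>UNIV. \<Sum>m\<in>UNIV. \<Sum>n\<in>UNIV. A i j k l m n * pd n (strain u l m) x)"

definition equilibrium ::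
  "(real^3) set \<Rightarrow> tensor4 \<Rightarrow> tensor5 \<Rightarrow> tensor6 \<Rightarrow> (real^3 \<Rightarrow> real^3) \<Rightarrow> bool" where
  "equilibrium B C M A u \<longleftrightarrow>
     (\<forall>x\<in>B. \<forall>i.
        (\<Sum>j\<in>UNIV. pd j (stress C M u i j) x) -
        (\<Sum>j\<in>UNIV. \<Sum>k\<in>UNIV. pd k (pd j (hyperstress M A u i j k)) x) = 0)"

definition invariant4 :: "(real^3^3) set \<Rightarrow> tensor4 \<Rightarrow> bool" where
  "invariant4 G T \<longleftrightarrow> (\<forall>Q\<in>G. \<forall>i1 i2 i3 i4.
     (\<Sum>j1\<in>UNIV. \<Sum>j2\<in>UNIV. \<Sum>j3\<in>UNIV. \<Sum>j4\<in>UNIV.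
        Q$i1$j1 * Q$i2$j2 * Q$i3$j3 * Q$i4$j4 * T j1 j2 j3 j4) = T i1 i2 i3 i4)"

definition invariant5 :: "(real^3^3) set \<Rightarrow> tensor5 \<Rightarrow> bool" where
  "invariant5 G T \<longleftrightarrow> (\<forall>Q\<in>G. \<forall>i1 i2 i3 i4 i5.
     (\<Sum>j1\<in>UNIV. \<Sum>j2\<in>UNIV. \<Sum>j3\<in>UNIV. \<Sum>j4\<in>UNIV. \<Sum>j5\<in>UNIV.
        Q$i1$j1 * Q$i2$j2 * Q$i3$j3 * Q$i4$j4 * Q$i5$j5 * T j1 j2 j3 j4 j5) =
     T i1 i2 i3 i4 i5)"

definition invariant6 :: "(real^3^3) set \<Rightarrow> tensor6 \<Rightarrow> bool" where
  "invariant6 G T \<longleftrightarrow> (\<forall>Q\<in>G. \<forall>i1 i2 i3 i4 i5 i6.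
     (\<Sum>j1\<in>UNIV. \<Sum>j2\<in>UNIV. \<Sum>j3\<in>UNIV. \<Sum>j4\<in>UNIV. \<Sum>j5\<in>UNIV. \<Sum>j6\<in>UNIV.
        Q$i1$j1 * Q$i2$j2 * Q$i3$j3 * Q$i4$j4 * Q$i5$j5 * Q$i6$j6 * T j1 j2 j3 j4 j5 j6) =
     T i1 i2 i3 i4 i5 i6)"

definition O3 :: "(real^3^3) monoid" where
  "O3 = \<lparr>carrier = {Q. orthogonal_matrix Q}, mult = (**), one = mat 1\<rparr>"

definition rot_e3 :: "real \<Rightarrow> real^3^3" where
  "rot_e3 t = vector [vector [cos t, - sin t, 0],
                      vector [sin t,   cos t, 0],
                      vector [    0,       0, 1]]"

definition rot_e2 :: "real \<Rightarrow> real^3^3" where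
  "rot_e2 t = vector [vector [  cos t, 0, sin t],
                      vector [      0, 1,     0],
                      vector [- sin t, 0, cos t]]"

(* The two-fold axis is e2. D3 is often generated with two-fold axis e1 instead; the two
   groups are conjugate by a quarter turn about e3, but the coordinate form of the universal
   displacements is not the same. The field inhomogeneous below belongs to the axis e2.
   For the axis e1 its a12 part (x1*x2, (x1^2 - x2^2)/2, 0) is not in equilibrium: with
   c = C 1 1 2 3 = - C 2 2 2 3 = C 1 3 1 2 (and M = 0, A = 0) it gives
   sigma_31 = 2*c*x1, sigma_32 = 2*c*x2, sigma_3j,j = 4*c. *)
definition D3 :: "(real^3^3) set" where
  "D3 = generate O3 {rot_e3 (2 * pi / 3), rot_e2 pi}"

definition D3_Z2c :: "(real^3^3) set" where
  "D3_Z2c = generate O3 (D3 \<union> {- mat 1})"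

definition trigonal_D3_class :: "(tensor4 \<times> tensor5 \<times> tensor6) set" where
  "trigonal_D3_class = {(C, M, A). material C M A \<and>
     invariant4 D3_Z2c C \<and> invariant5 D3 M \<and> invariant6 D3_Z2c A}"

definition universal_displacement ::
  "(real^3) set \<Rightarrow> (tensor4 \<times> tensor5 \<times> tensor6) set \<Rightarrow> (real^3 \<Rightarrow> real^3) \<Rightarrow> bool" where
  "universal_displacement B K u \<longleftrightarrow>
     displacement_field B u \<and> (\<forall>(C, M, A)\<in>K. equilibrium B C M A u)"

definition homogeneous :: "(real^3 \<Rightarrow> real^3) \<Rightarrow> bool" where
  "homogeneous u \<longleftrightarrow> (\<exists>(H :: real^3^3) b. \<forall>x. u x = H *v x + b)"

definition inhomogeneous ::
  "real \<Rightarrow> real \<Rightarrow> real \<Rightarrow> real \<Rightarrow> real \<Rightarrow> real^3 \<Rightarrow> real^3" where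
  "inhomogeneous a123 a12 a13 a23 b13 x = vector
     [a123 * x$1 * x$2 * x$3 + a12 * x$1 * x$2 + a13 * x$1 * x$3 + a23 * x$2 * x$3,
      1/2 * (a12 + a123 * x$3) * ((x$1)^2 - (x$2)^2) + b13 * x$1 * x$3 - a13 * x$2 * x$3,
      - a123 * (x$1)^2 * x$2 - (a23 + b13) * x$1 * x$2 + 1/3 * a123 * (x$2)^3
        - a13 * ((x$1)^2 - (x$2)^2)]"

end

theory Submission
  imports Defs
begin

text \<open>Write \<open>D i j k\<close> for \<open>u\<^sub>i\<^sub>,\<^sub>j\<^sub>k\<close>. Among the materials with \<open>M = 0\<close> and \<open>A = 0\<close> the equilibrium
  equations are linear in the six constants of \<open>C\<close>; separating them expresses all second derivatives
  through \<open>D 1 1 2\<close>, \<open>D 1 1 3\<close>, \<open>D 1 2 3\<close> and \<open>D 2 1 3\<close>. By the symmetry of third derivatives, every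
  first derivative of these four functions is zero or equal to \<open>c = u\<^sub>1\<^sub>,\<^sub>1\<^sub>2\<^sub>3\<close>. The single coupling
  tensor \<open>M = e\<^sub>3 \<otimes> e\<^sub>3 \<otimes> Im z\<^sup>3\<close> with \<open>z = x\<^sub>1 + \<i> x\<^sub>2\<close> adds the equation \<open>4 c = 0\<close>, so the Hessian of
  \<open>u\<close> is constant. Conversely, a displacement with constant Hessian has constant strain gradient, so
  only \<open>C\<close> enters the equilibrium equations, and an invariant \<open>C\<close> is a combination of the same six tensors.\<close>

section \<open>Partial derivatives\<close>

text \<open>The mean value theorem in direction \<open>a\<close> turns the second difference into
  \<open>h\<close> times the increment of \<open>f' _ a\<close> between two points at distance O(h)
  from \<open>x\<close>. Differentiability of \<open>f' _ a\<close> at \<open>x\<close> gives this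
  increment as \<open>h * g' b\<close> up to o(h), with no continuity assumption on second
  derivatives.\<close>

lemma second_difference_quotient:
  fixes f :: "'a::real_normed_vector \<Rightarrow> real"
  assumes "open B" "x \<in> B"
    and f': "\<And>y. y \<in> B \<Longrightarrow> (f has_derivative f' y) (at y)"
    and g': "((\<lambda>y. f' y a) has_derivative g') (at x)"
  shows "((\<lambda>h. (f (x + h *\<^sub>R a + h *\<^sub>R b) - f (x + h *\<^sub>R a) - f (x + h *\<^sub>R b) + f x) / h\<^sup>2)
           \<longlongrightarrow> g' b) (at_right 0)"
proof (rule tendstoI)
  fix e :: real assume "e > 0"
  \<comment> \<open>The error terms add up to \<open>h * e' * (2 * norm a + norm b)\<close> in the
    end. The summand 1 makes \<open>K\<close> positive and the final estimate strict, even for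
    \<open>a = b = 0\<close>.\<close>
  define K where "K = 2 * norm a + norm b + 1"
  have K: "K > 0" "2 * norm a + norm b < K" "norm a + norm b \<le> K"
    by (auto simp: K_def add_nonneg_pos)
  define e' where "e' = e / K"
  have e': "e' > 0" using \<open>e > 0\<close> K by (simp add: e'_def)
  interpret g': bounded_linear g' using g' by (rule has_derivative_bounded_linear)
  obtain d1 where d1: "d1 > 0"
    "\<And>y. norm (y - x) < d1 \<Longrightarrow> \<bar>f' y a - f' x a - g' (y - x)\<bar> \<le> e' * norm (y - x)"
    using g' e' unfolding has_derivative_at_alt real_norm_def by blast
  obtain d2 where d2: "d2 > 0" "ball x d2 \<subseteq> B"
    using assms(1,2) by (rule openE)
  define d where "d = min d1 d2 / K"
  have "d > 0" using d1 d2 K by (simp add: d_def)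
  have est: "dist ((f (x + h *\<^sub>R a + h *\<^sub>R b) - f (x + h *\<^sub>R a) - f (x + h *\<^sub>R b) + f x) / h\<^sup>2) (g' b) < e"
    if h: "0 < h" "h < d" for h
  proof -
    have near: "norm (t *\<^sub>R a + s *\<^sub>R b) < min d1 d2" if "0 \<le> t" "t \<le> h" "0 \<le> s" "s \<le> h" for t s
    proof -
      have "norm (t *\<^sub>R a + s *\<^sub>R b) \<le> t * norm a + s * norm b"
        using that norm_triangle_ineq[of "t *\<^sub>R a" "s *\<^sub>R b"] by simp
      also have "\<dots> \<le> h * (norm a + norm b)"
        using that by (simp add: distrib_left add_mono mult_right_mono)
      also have "\<dots> \<le> h * K" using h K by simp
      also have "\<dots> < d * K" using h K by simp
      finally show ?thesis using K by (simp add: d_def)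
    qed
    have inB: "x + (t *\<^sub>R a + s *\<^sub>R b) \<in> B" if "0 \<le> t" "t \<le> h" "0 \<le> s" "s \<le> h" for t s
      using near[OF that] norm_minus_cancel[of "t *\<^sub>R a + s *\<^sub>R b"]
      by (intro subsetD[OF d2(2)]) (simp add: dist_norm)
    \<comment> \<open>The redundant \<open>0 *\<^sub>R b\<close> makes both terms instances of the
      derivative rule \<open>D\<close>, with \<open>s = h\<close> and \<open>s = 0\<close>. Applying
      the mean value theorem to the difference gives one common \<xi> for both.\<close>
    define \<phi> where "\<phi> = (\<lambda>t. f (x + (t *\<^sub>R a + h *\<^sub>R b)) - f (x + (t *\<^sub>R a + 0 *\<^sub>R b)))"
    have D: "((\<lambda>t. f (x + (t *\<^sub>R a + s *\<^sub>R b))) has_derivative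
        (\<lambda>dt. f' (x + (t *\<^sub>R a + s *\<^sub>R b)) (dt *\<^sub>R a))) (at t within {0..h})"
      if "0 \<le> t" "t \<le> h" "0 \<le> s" "s \<le> h" for t s
    proof (rule has_derivative_compose[where g = f and f = "\<lambda>t. x + (t *\<^sub>R a + s *\<^sub>R b)"])
      show "((\<lambda>t. x + (t *\<^sub>R a + s *\<^sub>R b)) has_derivative (\<lambda>dt. dt *\<^sub>R a)) (at t within {0..h})"
        by (auto intro!: derivative_eq_intros)
    qed (rule f'[OF inB[OF that]])
    have "\<exists>\<xi>\<in>{0<..<h}. \<phi> h - \<phi> 0 = f' (x + (\<xi> *\<^sub>R a + h *\<^sub>R b)) ((h - 0) *\<^sub>R a)
        - f' (x + (\<xi> *\<^sub>R a + 0 *\<^sub>R b)) ((h - 0) *\<^sub>R a)"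
      unfolding \<phi>_def using h(1)
      by (intro mvt_simple has_derivative_diff D) auto
    then obtain \<xi> where \<xi>: "0 < \<xi>" "\<xi> < h"
      and eq: "\<phi> h - \<phi> 0 = f' (x + (\<xi> *\<^sub>R a + h *\<^sub>R b)) (h *\<^sub>R a) - f' (x + (\<xi> *\<^sub>R a + 0 *\<^sub>R b)) (h *\<^sub>R a)"
      by auto
    let ?y = "x + (\<xi> *\<^sub>R a + h *\<^sub>R b)" and ?z = "x + (\<xi> *\<^sub>R a + 0 *\<^sub>R b)"
    have lin: "f' y (h *\<^sub>R a) = h * f' y a" if "y \<in> B" for y
      using linear_cmul[OF has_derivative_linear[OF f'[OF that]], of h a] by simp
    have eq: "\<phi> h - \<phi> 0 = h * (f' ?y a - f' ?z a)"
      unfolding eq using \<xi> h(1) lin[of ?y] lin[of ?z] inB[of \<xi> h] inB[of \<xi> 0] by (simp add: right_diff_distrib)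
    have ny: "norm (?y - x) \<le> h * (norm a + norm b)"
    proof -
      have "norm (?y - x) \<le> \<xi> * norm a + h * norm b"
        using norm_triangle_ineq[of "\<xi> *\<^sub>R a" "h *\<^sub>R b"] \<xi> h by simp
      also have "\<dots> \<le> h * norm a + h * norm b" using \<xi> by (simp add: mult_right_mono)
      finally show ?thesis by (simp add: distrib_left)
    qed
    have nz: "norm (?z - x) \<le> h * norm a" using \<xi> by (simp add: mult_right_mono)
    have "\<bar>f' ?y a - f' x a - g' (?y - x)\<bar> \<le> e' * norm (?y - x)"
      using near[of \<xi> h] \<xi> h by (intro d1(2)) simp
    also have "\<dots> \<le> e' * (h * (norm a + norm b))" using ny e' by simp
    finally have y: "\<bar>f' ?y a - f' x a - g' (?y - x)\<bar> \<le> e' * (h * (norm a + norm b))" .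
    have "\<bar>f' ?z a - f' x a - g' (?z - x)\<bar> \<le> e' * norm (?z - x)"
      using near[of \<xi> 0] \<xi> h by (intro d1(2)) simp
    also have "\<dots> \<le> e' * (h * norm a)" using nz e' by simp
    finally have z: "\<bar>f' ?z a - f' x a - g' (?z - x)\<bar> \<le> e' * (h * norm a)" .
    have "g' (?y - x) - g' (?z - x) = h * g' b"
      by (simp add: g'.add g'.scaleR)
    then have "\<bar>f' ?y a - f' ?z a - h * g' b\<bar> \<le> e' * (h * (norm a + norm b)) + e' * (h * norm a)"
      using y z by linarith
    also have "\<dots> = h * (e' * (2 * norm a + norm b))" by (simp add: algebra_simps)
    also have "\<dots> < h * (e' * K)" using h e' K by simp
    also have "e' * K = e" using K by (simp add: e'_def)
    finally have "\<bar>f' ?y a - f' ?z a - h * g' b\<bar> < h * e" .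
    moreover have "(\<phi> h - \<phi> 0) / h\<^sup>2 - g' b = (f' ?y a - f' ?z a - h * g' b) / h"
      unfolding eq using h by (simp add: field_simps power2_eq_square)
    ultimately have "\<bar>(\<phi> h - \<phi> 0) / h\<^sup>2 - g' b\<bar> < e"
      using h by (simp add: abs_divide divide_less_eq mult.commute)
    moreover have "\<phi> h - \<phi> 0 = f (x + h *\<^sub>R a + h *\<^sub>R b) - f (x + h *\<^sub>R a) - f (x + h *\<^sub>R b) + f x"
      by (simp add: \<phi>_def add.assoc)
    ultimately show ?thesis by (simp add: dist_real_def)
  qed
  show "\<forall>\<^sub>F h in at_right 0. dist ((f (x + h *\<^sub>R a + h *\<^sub>R b) - f (x + h *\<^sub>R a) - f (x + h *\<^sub>R b) + f x) / h\<^sup>2) (g' b) < e"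
    unfolding eventually_at_right_field using \<open>d > 0\<close> est by auto
qed

text \<open>The second difference is symmetric in \<open>a\<close> and \<open>b\<close>, so the two
  limits of its quotient coincide.\<close>

lemma mixed_derivatives_commute:
  fixes f :: "'a::real_normed_vector \<Rightarrow> real"
  assumes "open B" "x \<in> B"
    and f': "\<And>y. y \<in> B \<Longrightarrow> (f has_derivative f' y) (at y)"
    and "((\<lambda>y. f' y a) has_derivative g') (at x)"
    and "((\<lambda>y. f' y b) has_derivative h') (at x)"
  shows "g' b = h' a"
  using second_difference_quotient[OF assms(1-4), of b]
    second_difference_quotient[OF assms(1-3) assms(5), of a]
  by (auto simp: algebra_simps intro: tendsto_unique[rotated])

section \<open>Rules for the operator \<open>pd\<close>\<close>

lemma pd_eq:
  assumes "(f has_derivative f') (at x)"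
  shows "pd i f x = f' (axis i 1)"
proof -
  have "((\<lambda>t. x + t *\<^sub>R axis i 1) has_derivative (\<lambda>dt. dt *\<^sub>R axis i 1)) (at (0::real))"
    by (auto intro!: derivative_eq_intros)
  then have "((\<lambda>t. f (x + t *\<^sub>R axis i 1)) has_derivative (\<lambda>dt. f' (dt *\<^sub>R axis i 1))) (at 0)"
    by (rule has_derivative_compose) (use assms in simp)
  moreover have "f' (dt *\<^sub>R axis i 1) = f' (axis i 1) * dt" for dt
    using linear_cmul[OF has_derivative_linear[OF assms]] by simp
  ultimately show ?thesis
    unfolding pd_def by (intro DERIV_imp_deriv) (simp add: has_field_derivative_def)
qed

lemma pd_frechet: "f differentiable (at x) \<Longrightarrow> pd i f x = frechet_derivative f (at x) (axis i 1)"
  by (rule pd_eq) (simp add: frechet_derivative_works)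

lemma pd_const [simp]: "pd i (\<lambda>x. c) = (\<lambda>x. 0)"
  by (simp add: pd_def fun_eq_iff)

lemma pd_add:
  assumes "f differentiable (at x)" "g differentiable (at x)"
  shows "pd i (\<lambda>x. f x + g x) x = pd i f x + pd i g x"
  using assms by (simp add: pd_frechet pd_eq[OF has_derivative_add] frechet_derivative_works)

lemma pd_cmult:
  assumes "f differentiable (at x)"
  shows "pd i (\<lambda>x. c * f x) x = c * pd i f x"
  using assms by (simp add: pd_frechet pd_eq[OF has_derivative_mult_right] frechet_derivative_works)

lemma pd_lincomb:
  assumes "f differentiable (at x)" "g differentiable (at x)"
  shows "pd i (\<lambda>x. a * f x + b * g x) x = a * pd i f x + b * pd i g x"
  using assms by (simp add: pd_add pd_cmult)

text \<open>As \<open>B\<close> is open, the line through \<open>x\<close> in direction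
  \<open>i\<close> stays in \<open>B\<close> for small parameters, so values on \<open>B\<close>
  alone determine the partial derivative. Identities that hold only on \<open>B\<close> can thus be
  differentiated.\<close>

lemma pd_cong:
  assumes "open B" "x \<in> B" "\<And>y. y \<in> B \<Longrightarrow> f y = g y"
  shows "pd i f x = pd i g x"
  unfolding pd_def
proof (rule deriv_cong_ev)
  have "((\<lambda>t. x + t *\<^sub>R axis i 1) \<longlongrightarrow> x + 0 *\<^sub>R axis i 1) (nhds (0::real))"
    by (intro tendsto_intros filterlim_ident)
  then have "\<forall>\<^sub>F t in nhds (0::real). x + t *\<^sub>R axis i 1 \<in> B"
    using assms(1,2) by (auto dest: topological_tendstoD)
  then show "\<forall>\<^sub>F t in nhds 0. f (x + t *\<^sub>R axis i 1) = g (x + t *\<^sub>R axis i 1)"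
    by eventually_elim (rule assms)
qed simp

lemma differentiable_cong:
  assumes "open B" "x \<in> B" "\<And>y. y \<in> B \<Longrightarrow> f y = g y" "g differentiable (at x)"
  shows "f differentiable (at x)"
  using assms has_derivative_transform_within_open[of g _ x UNIV B f]
  unfolding differentiable_def by metis

lemma iterated_pd_cong:
  assumes "open B" "\<And>y. y \<in> B \<Longrightarrow> f y = g y" "x \<in> B"
  shows "foldr pd ks f x = foldr pd ks g x"
  using assms(3)
proof (induction ks arbitrary: x)
  case Nil
  then show ?case using assms by simp
next
  case (Cons i ks)
  show ?case using pd_cong[OF assms(1) Cons.prems Cons.IH] by simp
qed

section \<open>Smooth functions on an open set\<close>

lemma smooth_on_cong:
  assumes "open B" "\<And>y. y \<in> B \<Longrightarrow> f y = g y" "smooth_on B g"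
  shows "smooth_on B f"
  unfolding smooth_on_def
proof safe
  fix ks x assume x: "x \<in> B"
  show "foldr pd ks f differentiable at x"
  proof (rule differentiable_cong[OF assms(1) x])
    show "foldr pd ks f y = foldr pd ks g y" if "y \<in> B" for y
      using iterated_pd_cong[OF assms(1,2) that] .
    show "foldr pd ks g differentiable at x" using assms(3) x by (simp add: smooth_on_def)
  qed
qed

lemma smooth_on_differentiable: "smooth_on B f \<Longrightarrow> x \<in> B \<Longrightarrow> f differentiable (at x)"
  unfolding smooth_on_def by (drule spec[of _ "[]"]) simp

lemma smooth_on_pd:
  assumes "smooth_on B f"
  shows "smooth_on B (pd i f)"
  unfolding smooth_on_def
proof safe
  fix ks x assume "x \<in> B"
  then have "foldr pd (ks @ [i]) f differentiable (at x)"
    using assms unfolding smooth_on_def by blast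
  then show "foldr pd ks (pd i f) differentiable (at x)" by simp
qed

text \<open>If a family of differentiable functions is closed under partial derivatives up to
  equality on \<open>B\<close>, then by induction every iterated derivative of a member agrees on
  \<open>B\<close> with a member. Equality on \<open>B\<close> is the right notion, since the rules
  for \<open>pd\<close> require differentiability, which is known only there.\<close>

lemma smooth_on_coinduct:
  assumes "open B" "F f"
    and step: "\<And>f. F f \<Longrightarrow> (\<forall>x\<in>B. f differentiable (at x)) \<and> (\<forall>i. \<exists>g. F g \<and> (\<forall>x\<in>B. pd i f x = g x))"
  shows "smooth_on B f"
proof -
  have "\<exists>g. F g \<and> (\<forall>x\<in>B. foldr pd ks f x = g x)" for ks
  proof (induction ks)
    case Nil
    then show ?case using assms(2) by auto
  next
    case (Cons i ks)
    then obtain g where g: "F g" "\<forall>x\<in>B. foldr pd ks f x = g x" by blast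
    then have "\<forall>x\<in>B. pd i (foldr pd ks f) x = pd i g x"
      using pd_cong[OF assms(1)] by blast
    with step[OF g(1)] show ?case by (metis comp_apply foldr_Cons)
  qed
  then show ?thesis
    unfolding smooth_on_def using differentiable_cong[OF assms(1)] step by metis
qed

lemma smooth_on_lincomb:
  assumes "open B" "smooth_on B f" "smooth_on B g"
  shows "smooth_on B (\<lambda>x. a * f x + b * g x)"
proof (rule smooth_on_coinduct[where F = "\<lambda>h. \<exists>f g. smooth_on B f \<and> smooth_on B g \<and> h = (\<lambda>x. a * f x + b * g x)"])
  fix h assume "\<exists>f g. smooth_on B f \<and> smooth_on B g \<and> h = (\<lambda>x. a * f x + b * g x)"
  then obtain f g where fg: "smooth_on B f" "smooth_on B g" and h: "h = (\<lambda>x. a * f x + b * g x)"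
    by blast
  note [simp] = fg[THEN smooth_on_differentiable]
  have "pd i h x = a * pd i f x + b * pd i g x" if "x \<in> B" for i x
    using that unfolding h by (simp add: pd_lincomb)
  moreover have "h differentiable (at x)" if "x \<in> B" for x
    using that unfolding h by simp
  ultimately show "(\<forall>x\<in>B. h differentiable (at x)) \<and>
      (\<forall>i. \<exists>h'. (\<exists>f g. smooth_on B f \<and> smooth_on B g \<and> h' = (\<lambda>x. a * f x + b * g x)) \<and> (\<forall>x\<in>B. pd i h x = h' x))"
    using fg[THEN smooth_on_pd] by blast
qed (use assms in auto)

lemma pd_sum:
  assumes "\<And>i. i \<in> I \<Longrightarrow> f i differentiable (at x)"
  shows "pd k (\<lambda>x. \<Sum>i\<in>I. f i x) x = (\<Sum>i\<in>I. pd k (f i) x)"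
  using assms
  by (induction I rule: infinite_finite_induct) (auto simp: pd_add)

text \<open>On \<open>B\<close> the Frechet derivative in a coordinate direction is the partial
  derivative, so it inherits the derivative of \<open>pd k f\<close>, and
  \<open>mixed_derivatives_commute\<close> applies.\<close>

lemma pd_commute:
  assumes "open B" "smooth_on B f" "x \<in> B"
  shows "pd i (pd j f) x = pd j (pd i f) x"
proof -
  define f' where "f' y = frechet_derivative f (at y)" for y
  have D: "(f has_derivative f' y) (at y)" if "y \<in> B" for y
    using smooth_on_differentiable[OF assms(2) that] by (simp add: f'_def frechet_derivative_works)
  have f'_pd: "f' y (axis k 1) = pd k f y" if "y \<in> B" for k y
    using pd_eq[OF D[OF that]] by simp
  have D2: "((\<lambda>y. f' y (axis k 1)) has_derivative frechet_derivative (pd k f) (at x)) (at x)" for k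
  proof (rule has_derivative_transform_within_open[OF _ assms(1,3)])
    show "(pd k f has_derivative frechet_derivative (pd k f) (at x)) (at x)"
      using smooth_on_differentiable[OF smooth_on_pd[OF assms(2)] assms(3)] frechet_derivative_works by blast
  qed (simp add: f'_pd)
  have "frechet_derivative (pd i f) (at x) (axis j 1) = frechet_derivative (pd j f) (at x) (axis i 1)"
    by (rule mixed_derivatives_commute[OF assms(1,3) D D2 D2])
  then show ?thesis
    using smooth_on_differentiable[OF smooth_on_pd[OF assms(2)] assms(3)] by (simp add: pd_frechet)
qed

text \<open>The Frechet derivative is linear and vanishes on the standard basis, hence it is zero;
  connectedness does the rest.\<close>

lemma zero_gradient_constant:
  assumes "open B" "connected B" "\<And>x. x \<in> B \<Longrightarrow> f differentiable (at x)"
    and "\<And>i x. x \<in> B \<Longrightarrow> pd i f x = 0"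
  shows "\<exists>c. \<forall>x\<in>B. f x = c"
proof -
  have "(f has_derivative (\<lambda>v. 0)) (at x)" if x: "x \<in> B" for x
  proof -
    have D: "(f has_derivative frechet_derivative f (at x)) (at x)"
      using assms(3)[OF x] frechet_derivative_works by blast
    then interpret bounded_linear "frechet_derivative f (at x)"
      by (rule has_derivative_bounded_linear)
    have "frechet_derivative f (at x) b = 0" if "b \<in> Basis" for b
      using that assms(4)[OF x] assms(3)[OF x] by (auto simp: Basis_vec_def pd_frechet)
    then have "frechet_derivative f (at x) = (\<lambda>v. 0)"
      by (intro linear_eq_stdbasis linear_axioms linear_zero) auto
    with D show ?thesis by simp
  qed
  then show ?thesis
    using has_derivative_zero_unique_connected[OF assms(1,2)] by (metis (no_types))
qed

section \<open>Quadratic polynomials and constant second derivatives\<close>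

definition quadratic :: "real \<Rightarrow> (3 \<Rightarrow> real) \<Rightarrow> (3 \<Rightarrow> 3 \<Rightarrow> real) \<Rightarrow> real^3 \<Rightarrow> real" where
  "quadratic c a H x = c + (\<Sum>i\<in>UNIV. a i * x$i) + (\<Sum>i\<in>UNIV. \<Sum>j\<in>UNIV. H i j * x$i * x$j) / 2"

lemma has_derivative_quadratic:
  "(quadratic c a H has_derivative
     (\<lambda>v. (\<Sum>i\<in>UNIV. a i * v$i) + (\<Sum>i\<in>UNIV. \<Sum>j\<in>UNIV. H i j * (x$i * v$j + v$i * x$j)) / 2)) (at x)"
  unfolding quadratic_def
  by (auto intro!: derivative_eq_intros bounded_linear.has_derivative[OF bounded_linear_vec_nth]
      simp: algebra_simps)

text \<open>Symmetry of \<open>H\<close> merges the two terms of the product rule and cancels the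
  factor 1/2. The result is again a \<open>quadratic\<close>, with zero second-order part, so the
  rule can be iterated.\<close>

lemma pd_quadratic:
  assumes "\<And>i j. H i j = H j i"
  shows "pd k (quadratic c a H) = quadratic (a k) (H k) (\<lambda>_ _. 0)"
proof
  fix x
  have "(\<Sum>i\<in>UNIV. a i * axis k 1 $ i) = a k"
    by (simp add: axis_def if_distrib[of "(*) _"] cong: if_cong)
  moreover have "(\<Sum>i\<in>UNIV. \<Sum>j\<in>UNIV. H i j * (x$i * axis k 1 $ j + axis k 1 $ i * x$j)) = 2 * (\<Sum>i\<in>UNIV. H k i * x$i)"
    by (simp add: axis_def if_distrib[of "(*) _"] if_distribR distrib_left sum.distrib assms[of _ k]
          if_distrib[of "\<lambda>x. x * _"] cong: if_cong) (simp add: sum.delta sum.swap mult.commute)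
  ultimately show "pd k (quadratic c a H) x = quadratic (a k) (H k) (\<lambda>_ _. 0) x"
    by (subst pd_eq[OF has_derivative_quadratic]) (simp add: quadratic_def)
qed

lemma quadratic_const: "quadratic c (\<lambda>_. 0) (\<lambda>_ _. 0) = (\<lambda>x. c)"
  by (simp add: quadratic_def fun_eq_iff)

lemma pd_pd_quadratic:
  assumes "\<And>i j. H i j = H j i"
  shows "pd l (pd k (quadratic c a H)) = (\<lambda>x. H k l)"
  by (simp add: pd_quadratic assms quadratic_const)

lemma smooth_on_quadratic:
  assumes "open B" "\<And>i j. H i j = H j i"
  shows "smooth_on B (quadratic c a H)"
proof (rule smooth_on_coinduct[where F = "\<lambda>f. \<exists>c a H. (\<forall>i j. H i j = H j i) \<and> f = quadratic c a H"])
  fix f assume "\<exists>c a H. (\<forall>i j. H i j = H j i) \<and> f = quadratic c a H"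
  then obtain c a H where "\<forall>i j. H i j = H j i" "f = quadratic c a H" by blast
  then have "f differentiable (at x)" "pd i f = quadratic (a i) (H i) (\<lambda>_ _. 0)" for x i
    using has_derivative_quadratic unfolding differentiable_def by (blast, simp add: pd_quadratic)
  then show "(\<forall>x\<in>B. f differentiable (at x)) \<and>
    (\<forall>i. \<exists>g. (\<exists>c a H. (\<forall>i j. H i j = H j i) \<and> g = quadratic c a H) \<and> (\<forall>x\<in>B. pd i f x = g x))"
    by (metis (no_types, lifting))
qed (use assms in blast)+

text \<open>Integration twice: each first derivative differs from the affine function with gradient
  \<open>H i\<close> by a constant \<open>a i\<close>, and then \<open>f\<close> differs from the
  polynomial with these linear coefficients by a constant.\<close>

lemma constant_second_derivatives_imp_quadratic:
  assumes "open B" "connected B" "smooth_on B f"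
    and sym: "\<And>i j. H i j = H j i"
    and "\<And>x i j. x \<in> B \<Longrightarrow> pd j (pd i f) x = H i j"
  shows "\<exists>c a. \<forall>x\<in>B. f x = quadratic c a H x"
proof -
  have "\<exists>a. \<forall>x\<in>B. pd i f x - quadratic 0 (H i) (\<lambda>_ _. 0) x = a" for i
  proof (rule zero_gradient_constant[OF assms(1,2)])
    let ?q = "quadratic 0 (H i) (\<lambda>_ _. 0)"
    fix x assume x: "x \<in> B"
    have f: "pd i f differentiable (at x)"
      using assms(3) x by (blast intro: smooth_on_pd smooth_on_differentiable)
    have q: "?q differentiable (at x)"
      using has_derivative_quadratic differentiable_def by blast
    show "(\<lambda>x. pd i f x - ?q x) differentiable (at x)" using f q by (rule differentiable_diff)
    show "pd j (\<lambda>x. pd i f x - ?q x) x = 0" for j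
      using pd_add[OF f, of "\<lambda>x. (-1) * ?q x" j] q assms(5)[OF x, of j i]
      by (simp add: pd_cmult[of _ _ _ "-1", simplified] pd_quadratic quadratic_const)
  qed
  then obtain a where a: "\<And>i x. x \<in> B \<Longrightarrow> pd i f x - quadratic 0 (H i) (\<lambda>_ _. 0) x = a i"
    by metis
  have "\<exists>c. \<forall>x\<in>B. f x - quadratic 0 a H x = c"
  proof (rule zero_gradient_constant[OF assms(1,2)])
    let ?q = "quadratic 0 a H"
    fix x assume x: "x \<in> B"
    have f: "f differentiable (at x)"
      using assms(3) x by (blast intro: smooth_on_differentiable)
    have q: "?q differentiable (at x)"
      using has_derivative_quadratic differentiable_def by blast
    show "(\<lambda>x. f x - ?q x) differentiable (at x)" using f q by (rule differentiable_diff)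
    show "pd j (\<lambda>x. f x - ?q x) x = 0" for j
      using pd_add[OF f, of "\<lambda>x. (-1) * ?q x" j] q a[OF x, of j] sym
      by (simp add: pd_cmult[of _ _ _ "-1", simplified] pd_quadratic) (simp add: quadratic_def)
  qed
  then obtain c where "\<forall>x\<in>B. f x - quadratic 0 a H x = c" by blast
  then have "\<forall>x\<in>B. f x = quadratic c a H x" by (auto simp: quadratic_def)
  then show ?thesis by blast
qed

section \<open>Invariants of the trigonal groups\<close>

text \<open>Inverses in \<open>O3\<close> are transposes, so the inverse case reduces to a left
  matrix inverse. Orthogonality is carried along because the elements of \<open>D3\<close> serve
  again as generators of \<open>D3_Z2c\<close>.\<close>

lemma generate_O3_induct:
  assumes "Q \<in> generate O3 H"
    and "\<And>h. h \<in> H \<Longrightarrow> orthogonal_matrix h \<and> P h"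
    and "P (mat 1)"
    and mult: "\<And>Q R. P Q \<Longrightarrow> P R \<Longrightarrow> P (Q ** R)"
    and inv: "\<And>Q R. P Q \<Longrightarrow> R ** Q = mat 1 \<Longrightarrow> P R"
  shows "orthogonal_matrix Q \<and> P Q"
  using assms(1)
proof (induction rule: generate.induct)
  case one
  then show ?case using assms(3) by (simp add: O3_def orthogonal_matrix_id)
next
  case (incl h)
  then show ?case using assms(2) by blast
next
  case (inv h)
  then have h: "orthogonal_matrix h" "P h" using assms(2) by blast+
  have "inv\<^bsub>O3\<^esub> h = transpose h"
    unfolding m_inv_def
  proof (rule the_equality)
    show "transpose h \<in> carrier O3 \<and> h \<otimes>\<^bsub>O3\<^esub> transpose h = \<one>\<^bsub>O3\<^esub> \<and> transpose h \<otimes>\<^bsub>O3\<^esub> h = \<one>\<^bsub>O3\<^esub>"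
      using h(1) by (auto simp: O3_def orthogonal_matrix_def)
    show "R = transpose h"
      if "R \<in> carrier O3 \<and> h \<otimes>\<^bsub>O3\<^esub> R = \<one>\<^bsub>O3\<^esub> \<and> R \<otimes>\<^bsub>O3\<^esub> h = \<one>\<^bsub>O3\<^esub>" for R
      using that h(1) unfolding O3_def orthogonal_matrix_def
      by simp (metis matrix_mul_assoc matrix_mul_lid matrix_mul_rid)
  qed
  moreover have "orthogonal_matrix (transpose h)" "transpose h ** h = mat 1"
    using h(1) by (auto simp: orthogonal_matrix_def)
  ultimately show ?case using assms(5) h(2) by auto
next
  case (eng h1 h2)
  then show ?case by (simp add: O3_def orthogonal_matrix_mul mult)
qed

section \<open>Forms preserved by the trigonal groups\<close>

definition planar_dot :: "real^3 \<Rightarrow> real^3 \<Rightarrow> real" where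
  "planar_dot a b = a$1 * b$1 + a$2 * b$2"

text \<open>The real and imaginary parts of the product of the complex numbers \<open>a$1 + \<i> a$2\<close>,
  \<open>b$1 + \<i> b$2\<close> and \<open>c$1 + \<i> c$2\<close>: a rotation by \<open>2\<pi>/3\<close> about \<open>e\<^sub>3\<close> multiplies each factor by a cube
  root of unity.\<close>

definition re3 :: "real^3 \<Rightarrow> real^3 \<Rightarrow> real^3 \<Rightarrow> real" where
  "re3 a b c = a$1 * b$1 * c$1 - a$1 * b$2 * c$2 - a$2 * b$1 * c$2 - a$2 * b$2 * c$1"

definition im3 :: "real^3 \<Rightarrow> real^3 \<Rightarrow> real^3 \<Rightarrow> real" where
  "im3 a b c = a$1 * b$1 * c$2 + a$1 * b$2 * c$1 + a$2 * b$1 * c$1 - a$2 * b$2 * c$2"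

text \<open>Vectors are multiplied from the left because contracting tensor indices with
  \<open>Q\<close> evaluates a form at rows of \<open>Q\<close>. The half turn about the second axis
  reverses both the third component and \<open>re3\<close>; their products survive, and being of
  even degree they also survive \<open>- mat 1\<close>.\<close>

definition preserves_even_forms :: "real^3^3 \<Rightarrow> bool" where
  "preserves_even_forms Q \<longleftrightarrow>
     (\<forall>a b. planar_dot (a v* Q) (b v* Q) = planar_dot a b \<and> (a v* Q)$3 * (b v* Q)$3 = a$3 * b$3) \<and>
     (\<forall>a b c d. re3 (a v* Q) (b v* Q) (c v* Q) * (d v* Q)$3 = re3 a b c * d$3)"

text \<open>The half turn keeps \<open>im3\<close>, whose terms contain the first component an even
  number of times, but \<open>- mat 1\<close> reverses it. This suits \<open>M\<close>, which must
  be invariant under \<open>D3\<close> only.\<close>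

definition preserves_odd_form :: "real^3^3 \<Rightarrow> bool" where
  "preserves_odd_form Q \<longleftrightarrow>
     (\<forall>a b. (a v* Q)$3 * (b v* Q)$3 = a$3 * b$3) \<and>
     (\<forall>a b c. im3 (a v* Q) (b v* Q) (c v* Q) = im3 a b c)"

lemma rot_e3_entries:
  "rot_e3 (2 * pi / 3) = vector [vector [-1/2, - sqrt 3 / 2, 0], vector [sqrt 3 / 2, -1/2, 0], vector [0, 0, 1]]"
proof -
  have c: "cos (2 * pi / 3) = -1/2" and s: "sin (2 * pi / 3) = sqrt 3 / 2"
    using cos_120 sin_120 by (auto simp: mult.commute)
  show ?thesis unfolding rot_e3_def c s by simp
qed

lemma rot_e2_entries:
  "rot_e2 pi = vector [vector [-1, 0, 0], vector [0, 1, 0], vector [0, 0, -1]]"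
  by (simp add: rot_e2_def)

lemma vector_matrix_mult_3:
  "(a v* Q) $ j = a$1 * Q$1$j + a$2 * Q$2$j + a$3 * Q$3$j" for Q :: "real^3^3"
  by (simp add: vector_matrix_mult_def sum_3 mult.commute)

lemma orthogonal_rot_e3: "orthogonal_matrix (rot_e3 t)"
  unfolding orthogonal_matrix
  by (simp add: vec_eq_iff forall_3 matrix_matrix_mult_def sum_3 mat_def transpose_def rot_e3_def
      flip: power2_eq_square)

lemma orthogonal_rot_e2: "orthogonal_matrix (rot_e2 t)"
  unfolding orthogonal_matrix
  by (simp add: vec_eq_iff forall_3 matrix_matrix_mult_def sum_3 mat_def transpose_def rot_e2_def
      flip: power2_eq_square)

lemma rot_e3_preserves:
  "preserves_even_forms (rot_e3 (2 * pi / 3))" "preserves_odd_form (rot_e3 (2 * pi / 3))"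
proof -
  \<comment> \<open>With a name for the irrational entry, the claims become polynomial identities
    modulo \<open>s * s = 3/4\<close>.\<close>
  define s where "s = sqrt 3 / 2"
  have s: "s * s = 3/4" by (simp add: s_def)
  have e: "(a v* rot_e3 (2 * pi / 3))$1 = - a$1 / 2 + a$2 * s"
    "(a v* rot_e3 (2 * pi / 3))$2 = - a$1 * s - a$2 / 2"
    "(a v* rot_e3 (2 * pi / 3))$3 = a$3" for a
    by (simp_all add: vector_matrix_mult_3 rot_e3_entries s_def)
  have "re3 (a v* rot_e3 (2 * pi / 3)) (b v* rot_e3 (2 * pi / 3)) (c v* rot_e3 (2 * pi / 3)) = re3 a b c" for a b c
    unfolding re3_def e using s by algebra
  moreover have "im3 (a v* rot_e3 (2 * pi / 3)) (b v* rot_e3 (2 * pi / 3)) (c v* rot_e3 (2 * pi / 3)) = im3 a b c" for a b c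
    unfolding im3_def e using s by algebra
  moreover have "planar_dot (a v* rot_e3 (2 * pi / 3)) (b v* rot_e3 (2 * pi / 3)) = planar_dot a b" for a b
    unfolding planar_dot_def e using s by algebra
  ultimately show "preserves_even_forms (rot_e3 (2 * pi / 3))" "preserves_odd_form (rot_e3 (2 * pi / 3))"
    by (simp_all add: preserves_even_forms_def preserves_odd_form_def e)
qed

lemma rot_e2_preserves:
  "preserves_even_forms (rot_e2 pi)" "preserves_odd_form (rot_e2 pi)"
  by (simp_all add: preserves_even_forms_def preserves_odd_form_def planar_dot_def re3_def im3_def
      vector_matrix_mult_3 rot_e2_entries algebra_simps)

lemma minus_one_preserves: "preserves_even_forms (- mat 1)"
  by (simp add: preserves_even_forms_def planar_dot_def re3_def vector_matrix_mult_3 mat_def algebra_simps)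

lemma preserves_even_forms_mult:
  "preserves_even_forms Q \<Longrightarrow> preserves_even_forms R \<Longrightarrow> preserves_even_forms (Q ** R)"
  unfolding preserves_even_forms_def by (simp flip: vector_matrix_mul_assoc)

text \<open>Since \<open>a v* R v* Q = a\<close>, inserting \<open>a v* R\<close> for
  \<open>a\<close> in the identities for \<open>Q\<close> yields those for \<open>R\<close>.\<close>

lemma preserves_even_forms_inverse:
  assumes "preserves_even_forms Q" "R ** Q = mat 1"
  shows "preserves_even_forms R"
proof -
  have "a v* R v* Q = a" for a using assms(2) by (simp add: vector_matrix_mul_assoc)
  with assms(1) show ?thesis unfolding preserves_even_forms_def by metis
qed

lemma preserves_odd_form_mult:
  "preserves_odd_form Q \<Longrightarrow> preserves_odd_form R \<Longrightarrow> preserves_odd_form (Q ** R)"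
  unfolding preserves_odd_form_def by (simp flip: vector_matrix_mul_assoc)

lemma preserves_odd_form_inverse:
  assumes "preserves_odd_form Q" "R ** Q = mat 1"
  shows "preserves_odd_form R"
proof -
  have "a v* R v* Q = a" for a using assms(2) by (simp add: vector_matrix_mul_assoc)
  with assms(1) show ?thesis unfolding preserves_odd_form_def by metis
qed

lemma D3_preserves:
  assumes "Q \<in> D3"
  shows "orthogonal_matrix Q" "preserves_even_forms Q" "preserves_odd_form Q"
proof -
  have gens: "orthogonal_matrix h \<and> preserves_even_forms h \<and> preserves_odd_form h"
    if "h \<in> {rot_e3 (2 * pi / 3), rot_e2 pi}" for h
    using that orthogonal_rot_e3 orthogonal_rot_e2 rot_e3_preserves rot_e2_preserves by blast
  have "orthogonal_matrix Q \<and> preserves_even_forms Q \<and> preserves_odd_form Q"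
    by (rule generate_O3_induct[OF assms[unfolded D3_def] gens])
      (auto simp: preserves_even_forms_mult preserves_odd_form_mult
        intro: preserves_even_forms_inverse preserves_odd_form_inverse,
       auto simp: preserves_even_forms_def preserves_odd_form_def)
  then show "orthogonal_matrix Q" "preserves_even_forms Q" "preserves_odd_form Q" by blast+
qed

lemma D3_Z2c_preserves:
  assumes "Q \<in> D3_Z2c"
  shows "preserves_even_forms Q"
proof -
  have "orthogonal_matrix (- mat 1 :: real^3^3)"
    unfolding orthogonal_matrix
    by (simp add: vec_eq_iff forall_3 matrix_matrix_mult_def sum_3 mat_def transpose_def)
  then have gens: "orthogonal_matrix h \<and> preserves_even_forms h" if "h \<in> D3 \<union> {- mat 1}" for h
    using that D3_preserves minus_one_preserves by blast
  have "orthogonal_matrix Q \<and> preserves_even_forms Q"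
    by (rule generate_O3_induct[OF assms[unfolded D3_Z2c_def] gens])
      (auto simp: preserves_even_forms_mult intro: preserves_even_forms_inverse,
       auto simp: preserves_even_forms_def)
  then show ?thesis ..
qed

text \<open>The general quadratic strain energy of the trigonal class, polarised: the squares and the
  product of \<open>e\<^sub>1\<^sub>1 + e\<^sub>2\<^sub>2\<close> and \<open>e\<^sub>3\<^sub>3\<close>, then \<open>(e\<^sub>1\<^sub>1 - e\<^sub>2\<^sub>2)\<^sup>2 + 4 e\<^sub>1\<^sub>2\<^sup>2\<close> and
  \<open>e\<^sub>1\<^sub>3\<^sup>2 + e\<^sub>2\<^sub>3\<^sup>2\<close>, and the term \<open>(e\<^sub>1\<^sub>1 - e\<^sub>2\<^sub>2) e\<^sub>1\<^sub>3 - 2 e\<^sub>1\<^sub>2 e\<^sub>2\<^sub>3\<close> that is not transversely isotropic.\<close>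

definition trigonal_form ::
  "real \<Rightarrow> real \<Rightarrow> real \<Rightarrow> real \<Rightarrow> real \<Rightarrow> real \<Rightarrow> real^3 \<Rightarrow> real^3 \<Rightarrow> real^3 \<Rightarrow> real^3 \<Rightarrow> real" where
  "trigonal_form k1 k2 k3 k4 k5 k6 a b c d =
     k1 * (planar_dot a b * planar_dot c d) +
     k2 * (planar_dot a b * (c$3 * d$3) + a$3 * b$3 * planar_dot c d) +
     k3 * (a$3 * b$3 * (c$3 * d$3)) +
     k4 * (planar_dot a c * planar_dot b d + planar_dot a d * planar_dot b c - planar_dot a b * planar_dot c d) +
     k5 * (planar_dot a c * (b$3 * d$3) + planar_dot a d * (b$3 * c$3) +
           planar_dot b c * (a$3 * d$3) + planar_dot b d * (a$3 * c$3)) +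
     k6 * (re3 a b c * d$3 + re3 a b d * c$3 + re3 a c d * b$3 + re3 b c d * a$3)"

definition trigonal_C :: "real \<Rightarrow> real \<Rightarrow> real \<Rightarrow> real \<Rightarrow> real \<Rightarrow> real \<Rightarrow> tensor4" where
  "trigonal_C k1 k2 k3 k4 k5 k6 i j l m =
     trigonal_form k1 k2 k3 k4 k5 k6 (axis i 1) (axis j 1) (axis l 1) (axis m 1)"

definition trigonal_M :: tensor5 where
  "trigonal_M i j l m n =
     axis i 1 $ 3 * axis j 1 $ 3 * im3 (axis l 1) (axis m 1) (axis n 1)"

section \<open>Invariant tensors in the class\<close>

lemmas trigonal_C_simps = trigonal_C_def trigonal_form_def planar_dot_def re3_def axis_def

lemmas trigonal_M_simps = trigonal_M_def im3_def axis_def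

text \<open>The form is multilinear and hence determined by its components. With rows of
  \<open>Q\<close> as the four vectors, the left side is the sum in \<open>invariant4\<close>, so
  invariance of the tensor follows from preservation of the form.\<close>

lemma sum_trigonal_C:
  "(\<Sum>j1\<in>UNIV. \<Sum>j2\<in>UNIV. \<Sum>j3\<in>UNIV. \<Sum>j4\<in>UNIV.
      a$j1 * b$j2 * c$j3 * d$j4 * trigonal_C k1 k2 k3 k4 k5 k6 j1 j2 j3 j4)
   = trigonal_form k1 k2 k3 k4 k5 k6 a b c d"
  unfolding sum_3
  by (simp add: trigonal_C_simps) (simp add: algebra_simps)

lemma sum_trigonal_M:
  "(\<Sum>j1\<in>UNIV. \<Sum>j2\<in>UNIV. \<Sum>j3\<in>UNIV. \<Sum>j4\<in>UNIV. \<Sum>j5\<in>UNIV.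
      a$j1 * b$j2 * c$j3 * d$j4 * e$j5 * trigonal_M j1 j2 j3 j4 j5)
   = a$3 * b$3 * im3 c d e"
  unfolding sum_3
  by (simp add: trigonal_M_simps) (simp add: algebra_simps)

lemma axis_vector_matrix_mult: "axis i 1 v* Q = Q $ i" for Q :: "real^3^3"
  by (simp add: vec_eq_iff vector_matrix_mult_def axis_def if_distrib[of "\<lambda>x. x * _"]
      if_distrib[of "(*) _"] if_distribR cong: if_cong)

lemma invariant4_trigonal_C: "invariant4 D3_Z2c (trigonal_C k1 k2 k3 k4 k5 k6)"
  unfolding invariant4_def
proof (intro ballI allI)
  fix Q i1 i2 i3 i4 assume "Q \<in> D3_Z2c"
  then have "preserves_even_forms Q" by (rule D3_Z2c_preserves)
  then have "trigonal_form k1 k2 k3 k4 k5 k6 (a v* Q) (b v* Q) (c v* Q) (d v* Q) = trigonal_form k1 k2 k3 k4 k5 k6 a b c d"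
    for a b c d
    unfolding preserves_even_forms_def trigonal_form_def by simp
  from this[of "axis i1 1" "axis i2 1" "axis i3 1" "axis i4 1"]
  show "(\<Sum>j1\<in>UNIV. \<Sum>j2\<in>UNIV. \<Sum>j3\<in>UNIV. \<Sum>j4\<in>UNIV.
      Q$i1$j1 * Q$i2$j2 * Q$i3$j3 * Q$i4$j4 * trigonal_C k1 k2 k3 k4 k5 k6 j1 j2 j3 j4)
    = trigonal_C k1 k2 k3 k4 k5 k6 i1 i2 i3 i4"
    unfolding sum_trigonal_C by (simp add: axis_vector_matrix_mult trigonal_C_def)
qed

lemma invariant5_trigonal_M: "invariant5 D3 trigonal_M"
  unfolding invariant5_def
proof (intro ballI allI)
  fix Q i1 i2 i3 i4 i5 assume "Q \<in> D3"
  then have "preserves_odd_form Q" by (rule D3_preserves)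
  then have "(a v* Q)$3 * (b v* Q)$3 * im3 (c v* Q) (d v* Q) (e v* Q) = a$3 * b$3 * im3 c d e" for a b c d e
    unfolding preserves_odd_form_def by simp
  from this[of "axis i1 1" "axis i2 1" "axis i3 1" "axis i4 1" "axis i5 1"]
  show "(\<Sum>j1\<in>UNIV. \<Sum>j2\<in>UNIV. \<Sum>j3\<in>UNIV. \<Sum>j4\<in>UNIV. \<Sum>j5\<in>UNIV.
      Q$i1$j1 * Q$i2$j2 * Q$i3$j3 * Q$i4$j4 * Q$i5$j5 * trigonal_M j1 j2 j3 j4 j5)
    = trigonal_M i1 i2 i3 i4 i5"
    unfolding sum_trigonal_M by (simp add: axis_vector_matrix_mult trigonal_M_def)
qed

lemma trigonal_C_in_class: "(trigonal_C k1 k2 k3 k4 k5 k6, \<lambda>_ _ _ _ _. 0, \<lambda>_ _ _ _ _ _. 0) \<in> trigonal_D3_class"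
proof -
  have "trigonal_C k1 k2 k3 k4 k5 k6 i j l m = trigonal_C k1 k2 k3 k4 k5 k6 j i l m"
    "trigonal_C k1 k2 k3 k4 k5 k6 i j l m = trigonal_C k1 k2 k3 k4 k5 k6 l m i j" for i j l m
    by (simp_all add: trigonal_C_def trigonal_form_def planar_dot_def re3_def algebra_simps)
  then show ?thesis
    using invariant4_trigonal_C[of k1 k2 k3 k4 k5 k6]
    by (auto simp: trigonal_D3_class_def material_def invariant5_def invariant6_def)
qed

lemma trigonal_M_in_class: "(\<lambda>_ _ _ _. 0, trigonal_M, \<lambda>_ _ _ _ _ _. 0) \<in> trigonal_D3_class"
proof -
  have "trigonal_M i j k l m = trigonal_M j i k l m" "trigonal_M i j k l m = trigonal_M i j l k m" for i j k l m
    by (simp_all add: trigonal_M_def im3_def algebra_simps)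
  then show ?thesis
    using invariant5_trigonal_M
    by (auto simp: trigonal_D3_class_def material_def invariant4_def invariant6_def)
qed

text \<open>The half turn removes all components with an odd number of indices 2; the threefold
  rotation gives linear relations among the others, which are then those of a
  \<open>trigonal_C\<close>.\<close>

lemma invariant4_imp_trigonal_C:
  assumes "invariant4 D3_Z2c C"
    and sym: "\<And>i j l m. C i j l m = C j i l m" "\<And>i j l m. C i j l m = C l m i j"
  shows "\<exists>k1 k2 k3 k4 k5 k6. C = trigonal_C k1 k2 k3 k4 k5 k6"
proof -
  have sym3: "C i j l m = C i j m l" for i j l m by (metis sym)
  have mem: "rot_e2 pi \<in> D3_Z2c" "rot_e3 (2 * pi / 3) \<in> D3_Z2c"
    by (auto simp: D3_Z2c_def D3_def intro: generate.incl)
  \<comment> \<open>The diagonal of the half turn; a product of four such signs is -1 exactly when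
    an odd number of the indices is 2.\<close>
  define \<epsilon> :: "3 \<Rightarrow> real" where "\<epsilon> i = (if i = 2 then 1 else -1)" for i
  have diag: "rot_e2 pi $ i $ j = (if i = j then \<epsilon> i else 0)" for i j
  proof -
    have "\<forall>i j. rot_e2 pi $ i $ j = (if i = j then \<epsilon> i else 0)"
      by (simp add: forall_3 rot_e2_entries \<epsilon>_def)
    then show ?thesis by blast
  qed
  have flip: "C i j l m = \<epsilon> i * \<epsilon> j * \<epsilon> l * \<epsilon> m * C i j l m" for i j l m
  proof -
    have "(\<Sum>j1\<in>UNIV. \<Sum>j2\<in>UNIV. \<Sum>j3\<in>UNIV. \<Sum>j4\<in>UNIV.
      rot_e2 pi$i$j1 * rot_e2 pi$j$j2 * rot_e2 pi$l$j3 * rot_e2 pi$m$j4 * C j1 j2 j3 j4) = C i j l m"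
      using assms(1) mem(1) unfolding invariant4_def by blast
    then show ?thesis
      by (simp add: diag if_distrib[of "(*) _"] if_distribR if_distrib[of "\<lambda>x. x * _"] cong: if_cong)
  qed
  have rot: "(\<Sum>j1\<in>UNIV. \<Sum>j2\<in>UNIV. \<Sum>j3\<in>UNIV. \<Sum>j4\<in>UNIV.
      rot_e3 (2 * pi / 3)$i1$j1 * rot_e3 (2 * pi / 3)$i2$j2 * rot_e3 (2 * pi / 3)$i3$j3 * rot_e3 (2 * pi / 3)$i4$j4
        * C j1 j2 j3 j4) = C i1 i2 i3 i4" for i1 i2 i3 i4
    using assms(1) mem(2) unfolding invariant4_def by blast
  \<comment> \<open>Oriented instances of the index symmetries, which rewrite each component to one
    representative of its orbit.\<close>
  note norm = sym(1)[of 2 1] sym(1)[of 3 1] sym(1)[of 3 2] sym3[of _ _ 2 1] sym3[of _ _ 3 1] sym3[of _ _ 3 2]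
    sym(2)[of 2 2 1 1] sym(2)[of 3 3 1 1] sym(2)[of 3 3 2 2] sym(2)[of 2 3 1 1] sym(2)[of 1 3 1 1] sym(2)[of 1 2 1 1]
    sym(2)[of 2 3 2 2] sym(2)[of 1 3 2 2] sym(2)[of 1 2 2 2] sym(2)[of 2 3 3 3] sym(2)[of 1 3 3 3] sym(2)[of 1 2 3 3]
    sym(2)[of 2 3 1 2] sym(2)[of 2 3 1 3] sym(2)[of 1 3 1 2]
  have zero: "C 1 1 2 3 = 0" "C 1 1 1 2 = 0" "C 2 2 2 3 = 0" "C 2 2 1 2 = 0" "C 3 3 2 3 = 0" "C 3 3 1 2 = 0"
    "C 1 3 2 3 = 0" "C 1 2 1 3 = 0"
    using flip[of 1 1 2 3] flip[of 1 1 1 2] flip[of 2 2 2 3] flip[of 2 2 1 2] flip[of 3 3 2 3] flip[of 3 3 1 2]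
      flip[of 1 3 2 3] flip[of 1 2 1 3] by (simp_all add: \<epsilon>_def)
  have sq: "sqrt 3 * (sqrt 3 * t) = 3 * t" for t
    by (simp flip: mult.assoc)
  have sq': "t * sqrt 3 * sqrt 3 = 3 * t" for t
    by (simp add: mult.assoc)
  note expand = sum_3 rot_e3_entries norm zero sq sq'
  have "C 2 2 3 3 = C 1 1 3 3" using rot[of 1 1 3 3] by (simp add: expand)
  moreover have "C 3 3 1 3 = 0" using rot[of 3 3 1 3] by (simp add: expand)
  moreover have "C 1 3 1 3 = C 2 3 2 3" using rot[of 1 3 1 3] by (simp add: expand)
  moreover have "C 2 2 1 3 = - C 1 1 1 3" "C 1 2 2 3 = - C 1 1 1 3"
    using rot[of 1 1 1 3] rot[of 2 2 1 3] by (simp_all add: expand)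
  moreover have "C 2 2 2 2 = C 1 1 1 1" "2 * C 1 2 1 2 = C 1 1 1 1 - C 1 1 2 2"
    using rot[of 1 1 1 1] rot[of 2 2 2 2] by (simp_all add: expand)
  \<comment> \<open>The constants are read off from the form: its 1111, 1122 and 1212 components are
    \<open>k1 + k4\<close>, \<open>k1 - k4\<close> and \<open>k4\<close>, while 1133, 3333, 2323 and
    1113 give \<open>k2\<close>, \<open>k3\<close>, \<open>k5\<close> and \<open>k6\<close>.\<close>
  ultimately have "\<forall>i j l m. C i j l m =
      trigonal_C ((C 1 1 1 1 + C 1 1 2 2) / 2) (C 1 1 3 3) (C 3 3 3 3) (C 1 2 1 2) (C 2 3 2 3) (C 1 1 1 3) i j l m"
    by (simp add: forall_3 trigonal_C_simps norm zero add_divide_distrib diff_divide_distrib)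
  then show ?thesis by (metis ext)
qed

text \<open>Here \<open>H i j k\<close> stands for \<open>D i j k\<close>, so the sums are the
  classical equilibrium equations. They are linear in the six constants; of the 18 second
  derivatives, 14 are fixed and four stay free.\<close>

lemma sum_trigonal_C_eq_0_iff:
  fixes H :: "3 \<Rightarrow> 3 \<Rightarrow> 3 \<Rightarrow> real"
  assumes sym: "\<And>i j k. H i j k = H i k j"
  shows "(\<forall>k1 k2 k3 k4 k5 k6 i. (\<Sum>j\<in>UNIV. \<Sum>l\<in>UNIV. \<Sum>m\<in>UNIV.
            trigonal_C k1 k2 k3 k4 k5 k6 i j l m * ((H l m j + H m l j) / 2)) = 0) \<longleftrightarrow>
    H 1 1 1 = 0 \<and> H 1 2 2 = 0 \<and> H 1 3 3 = 0 \<and> H 2 1 2 = 0 \<and> H 2 3 3 = 0 \<and>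
    H 2 1 1 = H 1 1 2 \<and> H 2 2 2 = - H 1 1 2 \<and> H 2 2 3 = - H 1 1 3 \<and>
    H 3 1 1 = - 2 * H 1 1 3 \<and> H 3 2 2 = 2 * H 1 1 3 \<and> H 3 1 2 = - (H 1 2 3 + H 2 1 3) \<and>
    H 3 1 3 = 0 \<and> H 3 2 3 = 0 \<and> H 3 3 3 = 0"
    (is "(\<forall>k1 k2 k3 k4 k5 k6 i. ?S k1 k2 k3 k4 k5 k6 i = 0) \<longleftrightarrow> ?R")
proof -
  note expand = sum_3 trigonal_C_simps sym[of _ 2 1] sym[of _ 3 1] sym[of _ 3 2]
  show ?thesis
  proof
    assume *: "\<forall>k1 k2 k3 k4 k5 k6 i. ?S k1 k2 k3 k4 k5 k6 i = 0"
    \<comment> \<open>One constant is 1 and the others are 0. The equations left out,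
      \<open>i = 3\<close> for \<open>k1\<close> and \<open>k4\<close> and \<open>i = 1, 2\<close>
      for \<open>k3\<close>, are trivial.\<close>
    have 1: "?S 1 0 0 0 0 0 1 = 0" "?S 1 0 0 0 0 0 2 = 0" "?S 0 1 0 0 0 0 1 = 0" "?S 0 1 0 0 0 0 2 = 0" "?S 0 1 0 0 0 0 3 = 0"
      "?S 0 0 1 0 0 0 3 = 0" "?S 0 0 0 1 0 0 1 = 0" "?S 0 0 0 1 0 0 2 = 0"
      "?S 0 0 0 0 1 0 1 = 0" "?S 0 0 0 0 1 0 2 = 0" "?S 0 0 0 0 1 0 3 = 0"
      "?S 0 0 0 0 0 1 1 = 0" "?S 0 0 0 0 0 1 2 = 0" "?S 0 0 0 0 0 1 3 = 0"
      using * by blast+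
    show ?R
      using 1 by (simp add: expand add_divide_distrib diff_divide_distrib)
  next
    assume ?R
    then show "\<forall>k1 k2 k3 k4 k5 k6 i. ?S k1 k2 k3 k4 k5 k6 i = 0"
      by (simp add: expand forall_3) (simp add: field_simps)
  qed
qed

section \<open>Equilibrium\<close>

lemma strain_eq:
  "strain u l m = (\<lambda>x. 1/2 * pd m (\<lambda>y. u y $ l) x + 1/2 * pd l (\<lambda>y. u y $ m) x)"
  by (simp add: strain_def fun_eq_iff)

lemma smooth_on_strain:
  assumes "open B" "displacement_field B u"
  shows "smooth_on B (strain u l m)"
  using assms unfolding strain_eq displacement_field_def
  by (intro smooth_on_lincomb smooth_on_pd) blast+

lemma pd_strain:
  assumes "displacement_field B u" "x \<in> B"
  shows "pd j (strain u l m) x =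
    (pd j (pd m (\<lambda>y. u y $ l)) x + pd j (pd l (\<lambda>y. u y $ m)) x) / 2"
proof -
  have "pd k (\<lambda>y. u y $ i) differentiable (at x)" for i k
    using assms unfolding displacement_field_def
    by (blast intro: smooth_on_pd smooth_on_differentiable)
  then show ?thesis unfolding strain_eq by (subst pd_lincomb) simp_all
qed

lemma strain_differentiable:
  assumes "open B" "displacement_field B u" "x \<in> B"
  shows "strain u l m differentiable (at x)" "pd n (strain u l m) differentiable (at x)"
  using smooth_on_strain[OF assms(1,2)] assms(3)
  by (blast intro: smooth_on_pd smooth_on_differentiable)+

lemma pd_stress:
  assumes "open B" "displacement_field B u" "x \<in> B"
  shows "pd k (stress C M u i j) x =
     (\<Sum>l\<in>UNIV. \<Sum>m\<in>UNIV. C i j l m * pd k (strain u l m) x) +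
     (\<Sum>l\<in>UNIV. \<Sum>m\<in>UNIV. \<Sum>n\<in>UNIV. M i j l m n * pd k (pd n (strain u l m)) x)"
  unfolding stress_def
  by (simp add: pd_add pd_sum pd_cmult strain_differentiable[OF assms])

lemma pd_hyperstress:
  assumes "open B" "displacement_field B u" "x \<in> B"
  shows "pd p (hyperstress M A u i j k) x =
     (\<Sum>l\<in>UNIV. \<Sum>m\<in>UNIV. M l m i j k * pd p (strain u l m) x) +
     (\<Sum>l\<in>UNIV. \<Sum>m\<in>UNIV. \<Sum>n\<in>UNIV. A i j k l m n * pd p (pd n (strain u l m)) x)"
  unfolding hyperstress_def
  by (simp add: pd_add pd_sum pd_cmult strain_differentiable[OF assms])

section \<open>Equilibrium with \<open>C\<close> alone or the coupling tensor alone\<close>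

lemma equilibrium_classical:
  assumes "open B" "displacement_field B u"
    and "equilibrium B C (\<lambda>_ _ _ _ _. 0) (\<lambda>_ _ _ _ _ _. 0) u" "x \<in> B"
  shows "(\<Sum>j\<in>UNIV. \<Sum>l\<in>UNIV. \<Sum>m\<in>UNIV. C i j l m *
    ((pd j (pd m (\<lambda>y. u y $ l)) x + pd j (pd l (\<lambda>y. u y $ m)) x) / 2)) = 0"
proof -
  have "hyperstress (\<lambda>_ _ _ _ _. 0) (\<lambda>_ _ _ _ _ _. 0) u i j k = (\<lambda>x. 0)" for i j k
    by (simp add: hyperstress_def fun_eq_iff)
  with assms(3,4) have "(\<Sum>j\<in>UNIV. pd j (stress C (\<lambda>_ _ _ _ _. 0) u i j) x) = 0"
    by (simp add: equilibrium_def)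
  then show ?thesis
    by (simp add: pd_stress[OF assms(1,2,4)] pd_strain[OF assms(2,4)])
qed

text \<open>This is the third equilibrium equation. The hyper-stress with first index 3 vanishes
  because \<open>im3\<close> does not see third components, and among the stresses with first index
  3 only the 33 component is nonzero.\<close>

lemma equilibrium_trigonal_M:
  assumes "open B" "displacement_field B u"
    and "equilibrium B (\<lambda>_ _ _ _. 0) trigonal_M (\<lambda>_ _ _ _ _ _. 0) u" "x \<in> B"
  shows "pd 3 (pd 2 (strain u 1 1)) x + pd 3 (pd 1 (strain u 1 2)) x + pd 3 (pd 1 (strain u 2 1)) x
    - pd 3 (pd 2 (strain u 2 2)) x = 0"
proof -
  have "hyperstress trigonal_M (\<lambda>_ _ _ _ _ _. 0) u 3 j k = (\<lambda>x. 0)" for j k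
    by (simp add: hyperstress_def fun_eq_iff trigonal_M_simps)
  with assms(3,4) have "(\<Sum>j\<in>UNIV. pd j (stress (\<lambda>_ _ _ _. 0) trigonal_M u 3 j) x) = 0"
    by (simp add: equilibrium_def)
  then show ?thesis
    by (simp add: pd_stress[OF assms(1,2,4)] sum_3 trigonal_M_simps)
qed

text \<open>The general solution of the 14 relations in \<open>sum_trigonal_C_eq_0_iff\<close>, with
  the entries 112, 113, 123 and 213 as parameters.\<close>

definition inhomogeneous_hessian :: "real \<Rightarrow> real \<Rightarrow> real \<Rightarrow> real \<Rightarrow> real^3^3^3" where
  "inhomogeneous_hessian a12 a13 a23 b13 = vector
    [vector [vector [0, a12, a13], vector [a12, 0, a23], vector [a13, a23, 0]],
     vector [vector [a12, 0, b13], vector [0, - a12, - a13], vector [b13, - a13, 0]],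
     vector [vector [- 2 * a13, - (a23 + b13), 0], vector [- (a23 + b13), 2 * a13, 0], vector [0, 0, 0]]]"

lemma inhomogeneous_hessian_sym:
  "inhomogeneous_hessian a12 a13 a23 b13 $ i $ j $ k = inhomogeneous_hessian a12 a13 a23 b13 $ i $ k $ j"
proof -
  have "\<forall>i j k. inhomogeneous_hessian a12 a13 a23 b13 $ i $ j $ k = inhomogeneous_hessian a12 a13 a23 b13 $ i $ k $ j"
    by (simp add: forall_3 inhomogeneous_hessian_def)
  then show ?thesis by blast
qed

lemma affine_plus_inhomogeneous:
  "((H :: real^3^3) *v x + b + inhomogeneous 0 a12 a13 a23 b13 x) $ i =
    quadratic (b $ i) (\<lambda>j. H $ i $ j) (\<lambda>j k. inhomogeneous_hessian a12 a13 a23 b13 $ i $ j $ k) x"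
proof -
  have "\<forall>i. (H *v x + b + inhomogeneous 0 a12 a13 a23 b13 x) $ i =
    quadratic (b $ i) (\<lambda>j. H $ i $ j) (\<lambda>j k. inhomogeneous_hessian a12 a13 a23 b13 $ i $ j $ k) x"
    by (simp add: forall_3 quadratic_def inhomogeneous_def inhomogeneous_hessian_def sum_3
        matrix_vector_mult_def power2_eq_square field_simps)
  then show ?thesis by blast
qed

lemma trigonal_D3_equilibrium:
  assumes "open B" "displacement_field B u" "(C, M, A) \<in> trigonal_D3_class"
    and D: "\<And>x i j k. x \<in> B \<Longrightarrow>
      pd k (pd j (\<lambda>y. u y $ i)) x = inhomogeneous_hessian a12 a13 a23 b13 $ i $ j $ k"
  shows "equilibrium B C M A u"
proof -
  define G where "G i j k = inhomogeneous_hessian a12 a13 a23 b13 $ i $ j $ k" for i j k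
  have strain1: "pd j (strain u l m) x = (G l m j + G m l j) / 2" if "x \<in> B" for x j l m
    using D that by (simp add: pd_strain[OF assms(2)] G_def)
  have strain2: "pd k (pd j (strain u l m)) x = 0" if "x \<in> B" for x j k l m
    using pd_cong[OF assms(1) that strain1] by simp
  \<comment> \<open>The second strain gradient vanishes, so the first derivatives of the
    hyper-stress are constant on \<open>B\<close> and its double divergence is zero, whatever
    \<open>M\<close> and \<open>A\<close> are.\<close>
  have hyper: "pd k (pd j (hyperstress M A u i j' k')) x = 0" if "x \<in> B" for x i j k j' k'
  proof -
    have "pd j (hyperstress M A u i j' k') y =
        (\<Sum>l\<in>UNIV. \<Sum>m\<in>UNIV. M l m i j' k' * ((G l m j + G m l j) / 2))" if "y \<in> B" for y
      using that by (simp add: pd_hyperstress[OF assms(1,2)] strain1 strain2)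
    from pd_cong[OF assms(1) that this] show ?thesis by simp
  qed
  obtain k1 k2 k3 k4 k5 k6 where C: "C = trigonal_C k1 k2 k3 k4 k5 k6"
    using assms(3) invariant4_imp_trigonal_C[of C]
    unfolding trigonal_D3_class_def material_def by blast
  have "G i j k = G i k j" for i j k
    unfolding G_def by (rule inhomogeneous_hessian_sym)
  from sum_trigonal_C_eq_0_iff[of G, OF this]
  have "(\<Sum>j\<in>UNIV. \<Sum>l\<in>UNIV. \<Sum>m\<in>UNIV. C i j l m * ((G l m j + G m l j) / 2)) = 0" for i
    unfolding C by (simp add: G_def inhomogeneous_hessian_def)
  then show ?thesis
    unfolding equilibrium_def
    by (simp add: hyper pd_stress[OF assms(1,2)] strain1 strain2)
qed

lemma universal_imp_hessian:
  assumes "open B" "connected B"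
    and univ: "universal_displacement B trigonal_D3_class u"
  shows "\<exists>a12 a13 a23 b13. \<forall>x\<in>B. \<forall>i j k.
    pd k (pd j (\<lambda>y. u y $ i)) x = inhomogeneous_hessian a12 a13 a23 b13 $ i $ j $ k"
\<comment> \<open>A base point \<open>x0\<close> supplies the four constants; for empty
  \<open>B\<close> the claim is vacuous.\<close>
proof (cases "B = {}")
  case False
  then obtain x0 where x0: "x0 \<in> B" by blast
  have u: "displacement_field B u" using univ by (simp add: universal_displacement_def)
  define D where "D i j k = pd k (pd j (\<lambda>y. u y $ i))" for i j k
  define T where "T i j k l = pd l (D i j k)" for i j k l
  have sm: "smooth_on B (pd j (\<lambda>y. u y $ i))" "smooth_on B (\<lambda>y. u y $ i)" for i j
    using u unfolding displacement_field_def by (blast intro: smooth_on_pd)+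
  have smD: "smooth_on B (D i j k)" for i j k
    unfolding D_def using sm by (blast intro: smooth_on_pd)
  have Dsym: "D i j k x = D i k j x" if "x \<in> B" for i j k x
    unfolding D_def by (rule pd_commute[OF assms(1) sm(2) that])
  have T12: "T i j k l x = T i k j l x" if "x \<in> B" for i j k l x
    unfolding T_def by (rule pd_cong[OF assms(1) that Dsym])
  have T23: "T i j k l x = T i j l k x" if "x \<in> B" for i j k l x
    unfolding T_def D_def by (rule pd_commute[OF assms(1) sm(1) that])
  have rel: "D 1 1 1 x = 0 \<and> D 1 2 2 x = 0 \<and> D 1 3 3 x = 0 \<and> D 2 1 2 x = 0 \<and> D 2 3 3 x = 0 \<and>
    D 2 1 1 x = D 1 1 2 x \<and> D 2 2 2 x = - D 1 1 2 x \<and> D 2 2 3 x = - D 1 1 3 x \<and>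
    D 3 1 1 x = - 2 * D 1 1 3 x \<and> D 3 2 2 x = 2 * D 1 1 3 x \<and> D 3 1 2 x = - (D 1 2 3 x + D 2 1 3 x) \<and>
    D 3 1 3 x = 0 \<and> D 3 2 3 x = 0 \<and> D 3 3 3 x = 0" if x: "x \<in> B" for x
  proof (rule sum_trigonal_C_eq_0_iff[THEN iffD1, of "\<lambda>i j k. D i j k x", OF Dsym[OF x]], intro allI)
    fix k1 k2 k3 k4 k5 k6 i
    have "equilibrium B (trigonal_C k1 k2 k3 k4 k5 k6) (\<lambda>_ _ _ _ _. 0) (\<lambda>_ _ _ _ _ _. 0) u"
      using univ trigonal_C_in_class unfolding universal_displacement_def by blast
    from equilibrium_classical[OF assms(1) u this x]
    show "(\<Sum>j\<in>UNIV. \<Sum>l\<in>UNIV. \<Sum>m\<in>UNIV. trigonal_C k1 k2 k3 k4 k5 k6 i j l m * ((D l m j x + D m l j x) / 2)) = 0"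
      by (simp add: D_def)
  qed
  have T0: "T i j k l x = 0" if "\<And>y. y \<in> B \<Longrightarrow> D i j k y = 0" "x \<in> B" for i j k l x
    unfolding T_def using pd_cong[OF assms(1) that(2,1)] by simp
  have T2113: "T 2 1 1 3 x = T 1 1 2 3 x" if "x \<in> B" for x
    unfolding T_def using rel by (intro pd_cong[OF assms(1) that]) blast
  have T2223: "T 2 2 2 3 x = - T 1 1 2 3 x" if "x \<in> B" for x
  proof -
    have "T 2 2 2 3 x = pd 3 (\<lambda>x. (-1) * D 1 1 2 x) x"
      unfolding T_def using rel by (intro pd_cong[OF assms(1) that]) simp
    also have "\<dots> = (-1) * pd 3 (D 1 1 2) x"
      by (rule pd_cmult[OF smooth_on_differentiable[OF smD that]])
    finally show ?thesis by (simp add: T_def)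
  qed
  have strain2: "pd k (pd j (strain u l m)) x = (T l m j k x + T m l j k x) / 2" if x: "x \<in> B" for l m j k x
  proof -
    have "pd k (pd j (strain u l m)) x = pd k (\<lambda>x. 1/2 * D l m j x + 1/2 * D m l j x) x"
      by (intro pd_cong[OF assms(1) x]) (simp add: pd_strain[OF u] D_def)
    also have "\<dots> = (T l m j k x + T m l j k x) / 2"
      using smooth_on_differentiable[OF smD x] by (subst pd_lincomb) (simp_all add: T_def)
    finally show ?thesis .
  qed
  have c: "T 1 1 2 3 x = 0" if x: "x \<in> B" for x
  proof -
    have "equilibrium B (\<lambda>_ _ _ _. 0) trigonal_M (\<lambda>_ _ _ _ _ _. 0) u"
      using univ trigonal_M_in_class unfolding universal_displacement_def by blast
    \<comment> \<open>With c for \<open>T 1 1 2 3 x\<close>, the strain 11 contributes c, the two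
      mixed strains together c + \<open>T 2 1 1 3 x\<close> = 2c, and the strain 22 contributes -
      \<open>T 2 2 2 3 x\<close> = c, which gives 4c = 0.\<close>
    from equilibrium_trigonal_M[OF assms(1) u this x]
    show ?thesis
      using T12[OF x, of 1 2 1 3] by (simp add: strain2[OF x] T2113[OF x] T2223[OF x])
  qed
  have const: "D i j k x = D i j k x0" if "x \<in> B" "\<And>l y. y \<in> B \<Longrightarrow> T i j k l y = 0" for i j k x
    using zero_gradient_constant[OF assms(1,2) smooth_on_differentiable[OF smD], of i j k] that x0
    unfolding T_def by metis
  have Tz: "T 1 1 1 l x = 0" "T 1 2 2 l x = 0" "T 1 3 3 l x = 0" "T 2 1 2 l x = 0" "T 2 3 3 l x = 0"
    if "x \<in> B" for l x
    using rel by (blast intro: T0 that)+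
  have all_l: "\<forall>l. T i j k l x = 0" if "T i j k 1 x = 0" "T i j k 2 x = 0" "T i j k 3 x = 0" for i j k x
    using that by (simp add: forall_3)
  \<comment> \<open>For this and the next three functions, each third derivative is moved by
    \<open>T12\<close> and \<open>T23\<close> to a derivative of a function that vanishes by
    \<open>rel\<close>, or to c. For instance \<open>T 1 1 2 2\<close> becomes
    \<open>T 1 2 2 1\<close>, a derivative of \<open>D 1 2 2\<close>.\<close>
  have p: "D 1 1 2 x = D 1 1 2 x0" if "x \<in> B" for x
  proof (rule const[OF that])
    fix l y assume y: "y \<in> B"
    have "\<forall>l. T 1 1 2 l y = 0"
      using y Tz[OF y] c[OF y] T23[OF y, of 1 1 2 1] T12[OF y, of 1 1 2 2] T23[OF y, of 1 2 1 2]
      by (intro all_l) auto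
    then show "T 1 1 2 l y = 0" ..
  qed
  have q: "D 1 1 3 x = D 1 1 3 x0" if "x \<in> B" for x
  proof (rule const[OF that])
    fix l y assume y: "y \<in> B"
    have "\<forall>l. T 1 1 3 l y = 0"
      using y Tz[OF y] c[OF y] T23[OF y, of 1 1 3 1] T23[OF y, of 1 1 3 2] T12[OF y, of 1 1 3 3] T23[OF y, of 1 3 1 3]
      by (intro all_l) auto
    then show "T 1 1 3 l y = 0" ..
  qed
  have r: "D 1 2 3 x = D 1 2 3 x0" if "x \<in> B" for x
  proof (rule const[OF that])
    fix l y assume y: "y \<in> B"
    have "\<forall>l. T 1 2 3 l y = 0"
      using y Tz[OF y] c[OF y] T23[OF y, of 1 2 3 1] T12[OF y, of 1 2 1 3] T23[OF y, of 1 2 3 2]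
        T12[OF y, of 1 2 3 3] T23[OF y, of 1 3 2 3]
      by (intro all_l) auto
    then show "T 1 2 3 l y = 0" ..
  qed
  have w: "D 2 1 3 x = D 2 1 3 x0" if "x \<in> B" for x
  proof (rule const[OF that])
    fix l y assume y: "y \<in> B"
    have "\<forall>l. T 2 1 3 l y = 0"
      using y Tz[OF y] c[OF y] T2113[OF y] T23[OF y, of 2 1 3 1] T23[OF y, of 2 1 3 2]
        T12[OF y, of 2 1 3 3] T23[OF y, of 2 3 1 3]
      by (intro all_l) auto
    then show "T 2 1 3 l y = 0" ..
  qed
  have "\<forall>i j k. D i j k x = inhomogeneous_hessian (D 1 1 2 x0) (D 1 1 3 x0) (D 1 2 3 x0) (D 2 1 3 x0) $ i $ j $ k"
    if x: "x \<in> B" for x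
    using rel[OF x] p[OF x] q[OF x] r[OF x] w[OF x]
    by (simp add: forall_3 inhomogeneous_hessian_def Dsym[OF x, of _ 2 1] Dsym[OF x, of _ 3 1] Dsym[OF x, of _ 3 2])
  then show ?thesis unfolding D_def by blast
qed simp

section \<open>Universal displacements as affine plus quadratic fields\<close>

theorem proposition3p13:
  fixes B :: "(real^3) set" and u :: "real^3 \<Rightarrow> real^3"
  assumes "open B" and "connected B"
  shows "universal_displacement B trigonal_D3_class u \<longleftrightarrow>
    (\<exists>h a123 a12 a13 a23 b13. homogeneous h \<and> a123 = 0 \<and>
       (\<forall>x\<in>B. u x = h x + inhomogeneous a123 a12 a13 a23 b13 x))"
proof
  assume univ: "universal_displacement B trigonal_D3_class u"
  then have sm: "smooth_on B (\<lambda>x. u x $ i)" for i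
    by (simp add: universal_displacement_def displacement_field_def)
  obtain a12 a13 a23 b13 where hess: "\<And>x i j k. x \<in> B \<Longrightarrow>
      pd k (pd j (\<lambda>y. u y $ i)) x = inhomogeneous_hessian a12 a13 a23 b13 $ i $ j $ k"
    using universal_imp_hessian[OF assms univ] by blast
  have "\<exists>c a. \<forall>x\<in>B. u x $ i = quadratic c a (\<lambda>j k. inhomogeneous_hessian a12 a13 a23 b13 $ i $ j $ k) x" for i
    using constant_second_derivatives_imp_quadratic[OF assms sm inhomogeneous_hessian_sym hess] by simp
  then obtain c a where ca: "\<And>i x. x \<in> B \<Longrightarrow>
      u x $ i = quadratic (c i) (a i) (\<lambda>j k. inhomogeneous_hessian a12 a13 a23 b13 $ i $ j $ k) x"
    by metis
  \<comment> \<open>The constants of the two integrations form the homogeneous part: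
    \<open>a\<close> is its matrix and \<open>c\<close> its translation.\<close>
  let ?h = "\<lambda>x. (\<chi> i j. a i j) *v x + (\<chi> i. c i)"
  have "u x = ?h x + inhomogeneous 0 a12 a13 a23 b13 x" if "x \<in> B" for x
    unfolding vec_eq_iff affine_plus_inhomogeneous using ca[OF that] by (simp add: quadratic_def)
  moreover have "homogeneous ?h" unfolding homogeneous_def by blast
  ultimately show "\<exists>h a123 a12 a13 a23 b13. homogeneous h \<and> a123 = 0 \<and>
       (\<forall>x\<in>B. u x = h x + inhomogeneous a123 a12 a13 a23 b13 x)" by blast
next
  assume "\<exists>h a123 a12 a13 a23 b13. homogeneous h \<and> a123 = 0 \<and>
       (\<forall>x\<in>B. u x = h x + inhomogeneous a123 a12 a13 a23 b13 x)"
  then obtain H b a12 a13 a23 b13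
    where u: "\<And>x. x \<in> B \<Longrightarrow> u x = H *v x + b + inhomogeneous 0 a12 a13 a23 b13 x"
    unfolding homogeneous_def by metis
  let ?q = "\<lambda>i. quadratic (b $ i) (\<lambda>j. H $ i $ j) (\<lambda>j k. inhomogeneous_hessian a12 a13 a23 b13 $ i $ j $ k)"
  have q: "u x $ i = ?q i x" if "x \<in> B" for x i
    using u[OF that] by (simp only: affine_plus_inhomogeneous)
  \<comment> \<open>Outside \<open>B\<close> the field \<open>u\<close> is arbitrary, so smoothness
    and second derivatives are carried over from the polynomial by congruence on the open
    set.\<close>
  have "smooth_on B (\<lambda>x. u x $ i)" for i
    by (rule smooth_on_cong[OF assms(1) q smooth_on_quadratic[OF assms(1) inhomogeneous_hessian_sym]])
  then have disp: "displacement_field B u" by (simp add: displacement_field_def)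
  have "pd k (pd j (\<lambda>y. u y $ i)) x = inhomogeneous_hessian a12 a13 a23 b13 $ i $ j $ k" if "x \<in> B" for x i j k
  proof -
    have "pd k (pd j (\<lambda>y. u y $ i)) x = pd k (pd j (?q i)) x"
      using iterated_pd_cong[OF assms(1) q that, where ks = "[k, j]"] by simp
    then show ?thesis by (simp add: pd_pd_quadratic[OF inhomogeneous_hessian_sym])
  qed
  with disp show "universal_displacement B trigonal_D3_class u"
    unfolding universal_displacement_def
    using trigonal_D3_equilibrium[OF assms(1) disp] by blast
qed

end
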